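(* Let $d\ge1$, $M>0$, and let $\mathbf F\in C^\infty([-M,M],\mathbb R^d)$. Suppose that for every $u\in[-M,M]$ there exists an integer $m\ge1$ such that $$\operatorname{rank}\{\mathbf F''(u),\dots,\mathbf F^{(m+1)}(u)\}=d .$$ Then $\mathbf F$ is strictly nonlinear on $[-M,M]$. The converse is wrong: there exists $\mathbf F\in C^\infty([-M,M],\mathbb R^d)$ which is strictly nonlinear on $[-M,M]$ but such that for some $u\in[-M,M]$ no integer $m\ge1$ satisfies $\operatorname{rank}\{\mathbf F''(u),\dots,\mathbf F^{(m+1)}(u)\}=d$.
   Context: A twice differentiable $\mathbf F=(F_1,\dots,F_d):[-M,M]\to\mathbb R^d$ is strictly nonlinear on $[-M,M]$ if for any sub-interval $I$ of $[-M,M]$ (with nonempty interior) the functions $F_1'',\dots,F_d''$ are linearly independent on $I$, i.e. for any constant vector $\xi\in\mathbb R^d$, if $\xi\cdot\mathbf F''(u)=0$ for all $u\in I$ then $\xi=0$. The rank of a finite set of vectors of $\mathbb R^d$ is the dimension of their span. *)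

theory Defs
  imports "HOL-Analysis.Analysis"
begin

text \<open>
  Derivatives are taken relative to \<open>S\<close>: on a compact interval they are one-sided at the end
  points and do not depend on the values of \<open>f\<close> outside \<open>S\<close>. Outside \<open>S\<close> the values of
  \<open>deriv_on\<close> carry no meaning.
\<close>

primrec deriv_on ::
    "real set \<Rightarrow> nat \<Rightarrow> (real \<Rightarrow> 'a::real_normed_vector) \<Rightarrow> real \<Rightarrow> 'a" where
  "deriv_on S 0 f = f"
| "deriv_on S (Suc n) f = (\<lambda>u. vector_derivative (deriv_on S n f) (at u within S))"

text \<open>Continuity of the derivatives need not be required, as each of them is differentiable.\<close>

definition smooth_on_set :: "real set \<Rightarrow> (real \<Rightarrow> 'a::real_normed_vector) \<Rightarrow> bool" where
  "smooth_on_set S f \<longleftrightarrow> (\<forall>n. deriv_on S n f differentiable_on S)"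

definition strictly_nonlinear_on :: "real set \<Rightarrow> (real \<Rightarrow> real ^ 'd) \<Rightarrow> bool" where
  "strictly_nonlinear_on S F \<longleftrightarrow>
     F differentiable_on S \<and> deriv_on S 1 F differentiable_on S \<and>
     (\<forall>I. is_interval I \<and> I \<subseteq> S \<and> interior I \<noteq> {} \<longrightarrow>
        (\<forall>\<xi>. (\<forall>u\<in>I. \<xi> \<bullet> deriv_on S 2 F u = 0) \<longrightarrow> \<xi> = 0))"

end

theory Submission
  imports Defs "HOL-Computational_Algebra.Polynomial"
begin

text \<open>
  If \<open>\<xi> \<bullet> F''\<close> vanishes on an open interval, so do all \<open>\<xi> \<bullet> F\<^sup>(\<^sup>k\<^sup>)\<close> with \<open>k \<ge> 2\<close>, and the rank
  condition at any point of the interval forces \<open>\<xi> = 0\<close>. For the converse, take the components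
  \<open>u\<^sup>-\<^sup>j exp (- 1 / u\<^sup>2)\<close> with distinct \<open>j\<close>. They are flat at \<open>0\<close>, and a linear combination
  \<open>P (1 / u) exp (- 1 / u\<^sup>2)\<close> of them has a derivative of the same form, with \<open>P\<close> replaced by
  \<open>2 X\<^sup>3 P - X\<^sup>2 P'\<close>. That map is injective on polynomials, for degree reasons.
\<close>

section \<open>Sufficiency of the rank condition\<close>

lemma inner_deriv_on_eq_0:
  fixes F :: "real \<Rightarrow> 'a::real_inner"
  assumes smooth: "smooth_on_set S F" and U: "open U" "U \<subseteq> S"
    and vanish: "\<And>u. u \<in> U \<Longrightarrow> \<xi> \<bullet> deriv_on S m F u = 0"
    and "m \<le> k" "u \<in> U"
  shows "\<xi> \<bullet> deriv_on S k F u = 0"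
  using \<open>m \<le> k\<close> \<open>u \<in> U\<close>
proof (induction k arbitrary: u rule: dec_induct)
  case base
  then show ?case by (rule vanish)
next
  case (step n)
  \<comment> \<open>At interior points of \<open>S\<close> the relative derivative is the ordinary
    one, which depends only on the values in \<open>U\<close>, where the function vanishes by
    induction.\<close>
  have "u \<in> interior S"
    using U step.prems interior_maximal by blast
  then have within: "at u within S = at u"
    by (rule at_within_interior)
  have "deriv_on S n F differentiable (at u within S)"
    using smooth step.prems U unfolding smooth_on_set_def differentiable_on_def by blast
  then have "(deriv_on S n F has_vector_derivative deriv_on S (Suc n) F u) (at u)"
    by (simp add: vector_derivative_works within)
  then have "((\<lambda>v. \<xi> \<bullet> deriv_on S n F v) has_vector_derivative \<xi> \<bullet> deriv_on S (Suc n) F u) (at u)"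
    by (rule bounded_linear.has_vector_derivative[OF bounded_linear_inner_right])
  moreover have "((\<lambda>v. \<xi> \<bullet> deriv_on S n F v) has_vector_derivative 0) (at u)"
    using has_vector_derivative_const
    by (rule has_vector_derivative_transform_within_open[OF _ U(1) step.prems])
      (simp add: step.IH)
  ultimately show ?case
    by (rule vector_derivative_unique_at)
qed

lemma strictly_nonlinear_onI_dim:
  fixes F :: "real \<Rightarrow> real ^ 'd"
  assumes smooth: "smooth_on_set S F"
    and dim: "\<And>u. u \<in> S \<Longrightarrow> \<exists>m. dim ((\<lambda>k. deriv_on S k F u) ` {2..m+1}) = CARD('d)"
  shows "strictly_nonlinear_on S F"
  unfolding strictly_nonlinear_on_def
proof (intro conjI allI impI)
  show "F differentiable_on S" "deriv_on S 1 F differentiable_on S"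
    using smooth[unfolded smooth_on_set_def, rule_format, of 0]
      smooth[unfolded smooth_on_set_def, rule_format, of 1] by simp_all
next
  fix I and \<xi> :: "real ^ 'd"
  assume I: "is_interval I \<and> I \<subseteq> S \<and> interior I \<noteq> {}"
    and \<xi>: "\<forall>u\<in>I. \<xi> \<bullet> deriv_on S 2 F u = 0"
  \<comment> \<open>One interior point suffices: all higher derivatives along \<open>\<xi>\<close>
    vanish there, so \<open>\<xi>\<close> is orthogonal to a spanning set and hence to
    itself.\<close>
  obtain u where u: "u \<in> interior I"
    using I by blast
  have sub: "interior I \<subseteq> I" by (rule interior_subset)
  then obtain m where m: "dim ((\<lambda>k. deriv_on S k F u) ` {2..m+1}) = CARD('d)"
    using dim u I by blast
  have "\<xi> \<bullet> deriv_on S k F u = 0" if "2 \<le> k" for k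
    by (rule inner_deriv_on_eq_0[OF smooth open_interior[of I] _ _ that u]) (use I \<xi> sub in auto)
  then have "\<forall>v \<in> (\<lambda>k. deriv_on S k F u) ` {2..m+1}. orthogonal \<xi> v"
    by (auto simp: orthogonal_def)
  then have "\<forall>v \<in> span ((\<lambda>k. deriv_on S k F u) ` {2..m+1}). orthogonal \<xi> v"
    using orthogonal_to_span by fast
  moreover have "span ((\<lambda>k. deriv_on S k F u) ` {2..m+1}) = UNIV"
    using m dim_eq_full[of "(\<lambda>k. deriv_on S k F u) ` {2..m+1}"] by simp
  ultimately have "orthogonal \<xi> \<xi>"
    by simp
  then show "\<xi> = 0"
    by (simp add: orthogonal_self)
qed

section \<open>Recognising iterated derivatives on a compact interval\<close>

text \<open>\<open>vector_derivative\<close> is a choice operator, so an explicit tower of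
  derivatives \<open>G\<close> determines it only where derivatives are unique; \<open>a < b\<close>
  ensures this, end points included.\<close>

lemma deriv_on_interval_eqI:
  fixes G :: "nat \<Rightarrow> real \<Rightarrow> 'a::real_normed_vector"
  assumes "a < b"
    and G: "\<And>n u. u \<in> {a..b} \<Longrightarrow> (G n has_vector_derivative G (Suc n) u) (at u within {a..b})"
  shows "u \<in> {a..b} \<Longrightarrow> deriv_on {a..b} n (G 0) u = G n u"
proof (induction n arbitrary: u)
  case (Suc n)
  have "(deriv_on {a..b} n (G 0) has_vector_derivative G (Suc n) u) (at u within {a..b})"
    by (rule has_vector_derivative_transform[OF Suc.prems _ G[OF Suc.prems]]) (rule Suc.IH)
  then show ?case
    unfolding deriv_on.simps
    by (rule vector_derivative_within_cbox[where a = a and b = b, unfolded box_real, OF assms(1) Suc.prems])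
qed simp

lemma smooth_on_intervalI:
  fixes G :: "nat \<Rightarrow> real \<Rightarrow> 'a::real_normed_vector"
  assumes "a < b"
    and G: "\<And>n u. u \<in> {a..b} \<Longrightarrow> (G n has_vector_derivative G (Suc n) u) (at u within {a..b})"
  shows "smooth_on_set {a..b} (G 0)"
  unfolding smooth_on_set_def differentiable_on_def
proof (intro allI ballI)
  fix n u assume u: "u \<in> {a..b}"
  have "(deriv_on {a..b} n (G 0) has_vector_derivative G (Suc n) u) (at u within {a..b})"
    by (rule has_vector_derivative_transform[OF u _ G[OF u]])
      (rule deriv_on_interval_eqI[where G = G, OF assms])
  then show "deriv_on {a..b} n (G 0) differentiable (at u within {a..b})"
    by (rule differentiableI_vector)
qed

section \<open>Flat functions encoded by polynomials\<close>

text \<open>Since \<open>1 / 0 = 0\<close> in HOL, the formula alone would give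
  \<open>poly p 0\<close> at the origin; the case distinction puts the limit there instead.\<close>

definition flat :: "real poly \<Rightarrow> real \<Rightarrow> real" where
  "flat p u = (if u = 0 then 0 else poly p (1 / u) * exp (- ((1 / u)\<^sup>2)))"

text \<open>This is the chain rule for \<open>y = 1 / u\<close>: the derivative of
  \<open>p(y) exp (- y^2)\<close> in \<open>y\<close> is \<open>(p' - 2 y p) exp (- y^2)\<close>,
  and \<open>dy/du = - y^2\<close>.\<close>

definition flat_deriv :: "real poly \<Rightarrow> real poly" where
  "flat_deriv p = [:0, 0, 1:] * ([:0, 2:] * p - pderiv p)"

lemma flat_0 [simp]: "flat p 0 = 0" "flat 0 u = 0"
  by (simp_all add: flat_def)

lemma flat_add: "flat (p + q) u = flat p u + flat q u"
  by (simp add: flat_def algebra_simps)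

lemma flat_smult: "flat (smult c p) u = c * flat p u"
  by (simp add: flat_def)

lemma flat_sum: "flat (sum p A) u = (\<Sum>i\<in>A. flat (p i) u)"
  by (induction A rule: infinite_finite_induct) (simp_all add: flat_add)

text \<open>By linearity monomials suffice, and for \<open>\<bar>y\<bar> \<ge> 1\<close> the
  inequality \<open>\<bar>y\<bar> \<le> y^2\<close> reduces the Gaussian to
  \<open>exp (- \<bar>y\<bar>)\<close>. The filter \<open>at_infinity\<close> covers both signs of
  \<open>y\<close>, hence both sides of \<open>u = 0\<close>.\<close>

lemma tendsto_poly_times_exp_minus_square:
  fixes p :: "real poly"
  shows "((\<lambda>y. poly p y * exp (- (y\<^sup>2))) \<longlongrightarrow> 0) at_infinity"
proof -
  have pow: "((\<lambda>y::real. y ^ k * exp (- (y\<^sup>2))) \<longlongrightarrow> 0) at_infinity" for k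
  proof (rule Lim_null_comparison)
    show "((\<lambda>y::real. norm y ^ k / exp (norm y)) \<longlongrightarrow> 0) at_infinity"
      by (rule filterlim_compose[OF tendsto_power_div_exp_0 filterlim_norm_at_top])
    have "norm (y ^ k * exp (- (y\<^sup>2))) \<le> norm y ^ k / exp (norm y)" if "1 \<le> norm y" for y :: real
    proof -
      have "norm y \<le> y\<^sup>2"
        using that power_increasing[of 1 2 "norm y"] by simp
      then have "exp (- (y\<^sup>2)) \<le> exp (- norm y)" by simp
      then show ?thesis
        by (simp add: abs_mult power_abs exp_minus divide_inverse mult_left_mono)
    qed
    then show "\<forall>\<^sub>F y::real in at_infinity. norm (y ^ k * exp (- (y\<^sup>2))) \<le> norm y ^ k / exp (norm y)"
      by (auto simp: eventually_at_infinity)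
  qed
  have "((\<lambda>y. \<Sum>i\<le>degree p. coeff p i * (y ^ i * exp (- (y\<^sup>2)))) \<longlongrightarrow> (\<Sum>i\<le>degree p. coeff p i * 0))
          at_infinity"
    by (intro tendsto_intros pow)
  then show ?thesis
    by (simp add: poly_altdef sum_distrib_right mult.assoc)
qed

lemma tendsto_flat_0: "(flat p \<longlongrightarrow> 0) (at 0)"
proof -
  have "((\<lambda>u. poly p (inverse u) * exp (- ((inverse u)\<^sup>2))) \<longlongrightarrow> 0) (at 0)"
    by (rule filterlim_compose[OF tendsto_poly_times_exp_minus_square filterlim_inverse_at_infinity])
  then show ?thesis
    by (rule Lim_transform_eventually)
      (auto simp: flat_def eventually_at_filter inverse_eq_divide)
qed

lemma flat_has_real_derivative: "(flat p has_real_derivative flat (flat_deriv p) u) (at u)"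
proof (cases "u = 0")
  case True
  \<comment> \<open>Dividing by \<open>h\<close> multiplies the polynomial in \<open>1 / h\<close>
    by its variable, so the difference quotient is \<open>flat (pCons 0 p)\<close>.\<close>
  have "((\<lambda>h. (flat p (0 + h) - flat p 0) / h) \<longlongrightarrow> 0) (at 0)"
    by (rule Lim_transform_eventually[OF tendsto_flat_0[of "pCons 0 p"]])
      (auto simp: flat_def eventually_at_filter)
  then show ?thesis
    using True by (simp add: DERIV_def)
next
  case False
  have "((\<lambda>u. poly p (1 / u) * exp (- ((1 / u)\<^sup>2))) has_real_derivative flat (flat_deriv p) u) (at u)"
    using False
    by (auto intro!: derivative_eq_intros DERIV_chain'[OF _ poly_DERIV]
        simp: flat_def flat_deriv_def field_simps power2_eq_square)
  then show ?thesis
    by (rule has_field_derivative_transform_within_open[of _ _ _ "- {0}"])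
      (use False in \<open>auto simp: flat_def\<close>)
qed

lemma flat_deriv_add: "flat_deriv (p + q) = flat_deriv p + flat_deriv q"
  by (simp add: flat_deriv_def pderiv_add smult_add_right algebra_simps)

lemma flat_deriv_smult: "flat_deriv (smult c p) = smult c (flat_deriv p)"
  by (simp add: flat_deriv_def pderiv_smult smult_diff_right)

lemma flat_deriv_sum: "flat_deriv (sum p A) = (\<Sum>i\<in>A. flat_deriv (p i))"
  by (induction A rule: infinite_finite_induct) (simp_all add: flat_deriv_add, simp_all add: flat_deriv_def)

text \<open>The equation \<open>p' = 2 X p\<close> is solved by the multiples of
  \<open>exp (x^2)\<close>; a nonzero polynomial fails it because the right side has degree above
  that of \<open>p\<close>.\<close>

lemma flat_deriv_eq_0_iff: "flat_deriv p = 0 \<longleftrightarrow> p = 0"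
proof
  assume "flat_deriv p = 0"
  then have eq: "[:0, 2:] * p = pderiv p"
    by (simp only: flat_deriv_def mult_eq_0_iff pCons_eq_0_iff right_minus_eq) simp
  show "p = 0"
  proof (rule ccontr)
    assume "p \<noteq> 0"
    then have "degree ([:0, 2:] * p) = Suc (degree p)"
      by (subst degree_mult_eq) auto
    then show False
      unfolding eq by (simp add: degree_pderiv)
  qed
qed (simp add: flat_deriv_def)

text \<open>The exponential factor has no zeros, so inversion would turn the infinitely many nonzero
  interior points of \<open>I\<close> into roots of \<open>p\<close>.\<close>

lemma flat_eq_0_on_interval:
  assumes I: "is_interval I" "interior I \<noteq> {}" and zero: "\<And>u. u \<in> I \<Longrightarrow> flat p u = 0"
  shows "p = 0"
proof (rule ccontr)
  assume "p \<noteq> 0"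
  then have "finite {x. poly p x = 0}"
    by (rule poly_roots_finite)
  moreover have "(\<lambda>u. 1 / u) ` (interior I - {0}) \<subseteq> {x. poly p x = 0}"
  proof clarify
    fix u assume "u \<in> interior I" "u \<noteq> 0"
    then show "poly p (1 / u) = 0"
      using zero[of u] interior_subset[of I] by (auto simp: flat_def)
  qed
  moreover have "inj_on (\<lambda>u::real. 1 / u) (interior I - {0})"
    by (auto simp: inj_on_def)
  ultimately have "finite (interior I - {0})"
    using finite_subset finite_imageD by blast
  then have "finite (interior I)" by simp
  then show False
    using I(2) open_interior finite_imp_not_open by blast
qed

section \<open>The strictly nonlinear curve that is flat at the origin\<close>

lemma flat_curve_has_vector_derivative:
  fixes p :: "'d::finite \<Rightarrow> real poly"
  shows "((\<lambda>u. \<chi> i. flat (p i) u) has_vector_derivative (\<chi> i. flat (flat_deriv (p i)) u)) (at u within S)"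
proof -
  \<comment> \<open>Expansion in the standard basis reduces the vector derivative to scalar
    ones.\<close>
  have comp: "(\<chi> i. f i) = (\<Sum>i\<in>UNIV. f i *\<^sub>R axis i 1)" for f :: "'d \<Rightarrow> real"
    by (simp add: vec_eq_iff axis_def if_distrib cong: if_cong)
  have "(flat (p i) has_vector_derivative flat (flat_deriv (p i)) u) (at u within S)" for i
    using flat_has_real_derivative
    by (simp add: has_real_derivative_iff_has_vector_derivative has_vector_derivative_at_within)
  from bounded_linear.has_vector_derivative[OF bounded_linear_scaleR_left this]
  show ?thesis
    unfolding comp by (intro has_vector_derivative_sum)
qed

lemma strictly_nonlinear_flat_curve_exists:
  fixes a b :: real
  assumes "a < b" "0 \<in> {a..b}"
  shows "\<exists>F :: real \<Rightarrow> real ^ 'd. smooth_on_set {a..b} F \<and> strictly_nonlinear_on {a..b} F \<and>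
           (\<forall>k. deriv_on {a..b} k F 0 = 0)"
proof -
  \<comment> \<open>Distinct exponents make the component monomials linearly independent.\<close>
  obtain e :: "'d \<Rightarrow> nat" where e: "inj e"
    using finite_imp_inj_to_nat_seg[of "UNIV :: 'd set"] by auto
  define p where "p i = (monom 1 (e i) :: real poly)" for i
  define G where "G n u = (\<chi> i. flat ((flat_deriv ^^ n) (p i)) u)" for n u
  have G: "(G n has_vector_derivative G (Suc n) u) (at u within {a..b})" for n u
    unfolding G_def using flat_curve_has_vector_derivative by simp
  note deriv_G = deriv_on_interval_eqI[where G = G, OF assms(1) G]
  have smooth: "smooth_on_set {a..b} (G 0)"
    by (rule smooth_on_intervalI[where G = G, OF assms(1) G])
  have "strictly_nonlinear_on {a..b} (G 0)"
    unfolding strictly_nonlinear_on_def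
  proof (intro conjI allI impI)
    show "G 0 differentiable_on {a..b}" "deriv_on {a..b} 1 (G 0) differentiable_on {a..b}"
      using smooth[unfolded smooth_on_set_def, rule_format, of 0]
      smooth[unfolded smooth_on_set_def, rule_format, of 1] by simp_all
  next
    fix I and \<xi> :: "real ^ 'd"
    assume I: "is_interval I \<and> I \<subseteq> {a..b} \<and> interior I \<noteq> {}"
      and \<xi>: "\<forall>u\<in>I. \<xi> \<bullet> deriv_on {a..b} 2 (G 0) u = 0"
    \<comment> \<open>By linearity \<open>flat P\<close> is \<open>\<xi> \<bullet> G 0\<close>, so
      two applications of \<open>flat_deriv\<close> encode the second derivative along
      \<open>\<xi>\<close>.\<close>
    define P where "P = (\<Sum>i\<in>UNIV. smult (\<xi> $ i) (p i))"
    have eq: "flat (flat_deriv (flat_deriv P)) u = \<xi> \<bullet> G 2 u" for u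
      by (simp add: P_def G_def inner_vec_def flat_sum flat_smult flat_deriv_sum flat_deriv_smult
          numeral_2_eq_2)
    have "flat (flat_deriv (flat_deriv P)) u = 0" if "u \<in> I" for u
    proof -
      have "u \<in> {a..b}"
        using I that by blast
      then have "deriv_on {a..b} 2 (G 0) u = G 2 u"
        by (rule deriv_G)
      then show ?thesis
        using bspec[OF \<xi> that] by (simp only: eq)
    qed
    then have "flat_deriv (flat_deriv P) = 0"
      using I flat_eq_0_on_interval by blast
    then have "P = 0"
      by (simp add: flat_deriv_eq_0_iff)
    \<comment> \<open>Injectivity of \<open>e\<close> leaves a single term in this
      coefficient.\<close>
    moreover have "coeff P (e j) = \<xi> $ j" for j
      by (simp add: P_def p_def coeff_sum inj_eq[OF e] if_distrib cong: if_cong)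
    ultimately show "\<xi> = 0"
      by (simp add: vec_eq_iff)
  qed
  moreover have "deriv_on {a..b} k (G 0) 0 = 0" for k
    using deriv_G[OF assms(2)] by (simp add: G_def vec_eq_iff)
  ultimately show ?thesis
    using smooth by blast
qed

theorem proposition3p2:
  fixes M :: real
  assumes "M > 0"
  shows "(\<forall>F :: real \<Rightarrow> real ^ 'd.
            smooth_on_set {-M..M} F \<and>
            (\<forall>u\<in>{-M..M}. \<exists>m\<ge>1. dim ((\<lambda>k. deriv_on {-M..M} k F u) ` {2..m+1}) = CARD('d))
            \<longrightarrow> strictly_nonlinear_on {-M..M} F)
       \<and> (\<exists>F :: real \<Rightarrow> real ^ 'd.
            smooth_on_set {-M..M} F \<and>
            strictly_nonlinear_on {-M..M} F \<and>
            (\<exists>u\<in>{-M..M}. \<not> (\<exists>m\<ge>1. dim ((\<lambda>k. deriv_on {-M..M} k F u) ` {2..m+1}) = CARD('d))))"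
proof (intro conjI allI impI)
  fix F :: "real \<Rightarrow> real ^ 'd"
  assume "smooth_on_set {-M..M} F \<and>
    (\<forall>u\<in>{-M..M}. \<exists>m\<ge>1. dim ((\<lambda>k. deriv_on {-M..M} k F u) ` {2..m+1}) = CARD('d))"
  then show "strictly_nonlinear_on {-M..M} F"
    by (intro strictly_nonlinear_onI_dim) blast+
next
  have M: "-M < M" "0 \<in> {-M..M}"
    using assms by auto
  obtain F :: "real \<Rightarrow> real ^ 'd" where F: "smooth_on_set {-M..M} F"
    "strictly_nonlinear_on {-M..M} F" "\<And>k. deriv_on {-M..M} k F 0 = 0"
    using strictly_nonlinear_flat_curve_exists[OF M] by blast
  \<comment> \<open>Only zero vectors occur at the origin, whereas \<open>CARD('d)\<close> is
    positive.\<close>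
  have "dim ((\<lambda>k. deriv_on {-M..M} k F 0) ` A) = 0" for A
    by (auto simp: F(3))
  then have "\<not> (\<exists>m\<ge>1. dim ((\<lambda>k. deriv_on {-M..M} k F 0) ` {2..m+1}) = CARD('d))"
    by (simp only:) simp
  then show "\<exists>F :: real \<Rightarrow> real ^ 'd.
            smooth_on_set {-M..M} F \<and>
            strictly_nonlinear_on {-M..M} F \<and>
            (\<exists>u\<in>{-M..M}. \<not> (\<exists>m\<ge>1. dim ((\<lambda>k. deriv_on {-M..M} k F u) ` {2..m+1}) = CARD('d)))"
    using F(1,2) M(2) by blast
qed

end
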